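(* Let $n,k\ge 0$ be integers with $n-k\equiv 0 \pmod 2$. Then $$\frac{x^n}{k!}\sum_{l=0}^{k}\binom{k}{l}(-1)^{k-l}\Big(l-\frac{k}{2}\Big)^{n}=\begin{cases}T_{n,k}(x,x^2,\dots,x^{n-k+1}), & \text{if } n\ge k,\\ 0, & \text{if } n<k.\end{cases}$$ In particular, $$\frac{1}{k!}\sum_{l=0}^{k}\binom{k}{l}(-1)^{k-l}\Big(l-\frac{k}{2}\Big)^{n}=\begin{cases}T_{n,k}(1,1,\dots,1), & \text{if } n\ge k,\\ 0, & \text{if } n<k.\end{cases}$$
   Context: The central incomplete Bell polynomials $T_{n,k}(x_1,x_2,\dots,x_{n-k+1})$ ($n\ge k\ge 0$) are defined by the identity of formal power series in $t$, for each $k=0,1,2,\dots$ and indeterminates (or real numbers) $x_1,x_2,\dots$: $$\frac{1}{k!}\Big(\sum_{m=1}^\infty \frac{1}{2^m}\big(x_m-(-1)^m x_m\big)\frac{t^m}{m!}\Big)^k=\sum_{n=k}^\infty T_{n,k}(x_1,x_2,\dots,x_{n-k+1})\frac{t^n}{n!}.$$ The coefficient $T_{n,k}$ depends only on $x_1,\dots,x_{n-k+1}$. $T_{n,k}(x,x^2,\dots,x^{n-k+1})$ denotes its value at $x_m=x^m$, and $T_{n,k}(1,\dots,1)$ its value at $x_m=1$. Here $x$ is an indeterminate (or a real number), and $0^0=1$. *)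

theory Defs
  imports "HOL-Computational_Algebra.Formal_Power_Series" "HOL-Number_Theory.Cong"
begin

definition central_bell_series :: "(nat \<Rightarrow> 'a::field_char_0) \<Rightarrow> 'a fps" where
  "central_bell_series x =
     Abs_fps (\<lambda>m. if m = 0 then 0 else 1 / 2 ^ m * (x m - (- 1) ^ m * x m) / fact m)"

(* The argument is an infinite sequence whose entry at 0 is irrelevant; for k \<le> n only
   x 1, ..., x (n - k + 1) matter (lemma central_bell_cong below).  For n < k the
   value is 0 by convention. *)
definition central_bell :: "nat \<Rightarrow> nat \<Rightarrow> (nat \<Rightarrow> 'a::field_char_0) \<Rightarrow> 'a" where
  "central_bell n k x = fact n * fps_nth (fps_const (1 / fact k) * central_bell_series x ^ k) n"

lemma central_bell_series_shift:
  "central_bell_series x = fps_X * fps_shift 1 (central_bell_series x)"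
  by (rule fps_ext) (simp add: central_bell_series_def)

lemma central_bell_series_power_nth:
  "fps_nth (central_bell_series x ^ k) n =
     (if n < k then 0 else fps_nth (fps_shift 1 (central_bell_series x) ^ k) (n - k))"
  by (subst central_bell_series_shift) (simp add: power_mult_distrib fps_X_power_mult_nth)

(* The defining generating function identity of the central incomplete Bell polynomials. *)
lemma central_bell_gf:
  "fps_const (1 / fact k) * central_bell_series x ^ k =
     Abs_fps (\<lambda>n. if k \<le> n then central_bell n k x / fact n else 0)"
  by (rule fps_ext) (simp add: central_bell_def central_bell_series_power_nth)

lemma fps_power_nth_cong:
  fixes f g :: "'a::comm_ring_1 fps"
  assumes "\<And>i. i \<le> n \<Longrightarrow> fps_nth f i = fps_nth g i" "m \<le> n"
  shows "fps_nth (f ^ k) m = fps_nth (g ^ k) m"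
  using assms(2)
proof (induction k arbitrary: m)
  case 0
  then show ?case by simp
next
  case (Suc k)
  then show ?case
    using assms(1) by (auto simp: fps_mult_nth intro!: sum.cong)
qed

lemma central_bell_cong:
  assumes "k \<le> n" "\<And>i. 1 \<le> i \<Longrightarrow> i \<le> n - k + 1 \<Longrightarrow> x i = y i"
  shows "central_bell n k x = central_bell n k y"
proof -
  have "fps_nth (fps_shift 1 (central_bell_series x) ^ k) (n - k) =
        fps_nth (fps_shift 1 (central_bell_series y) ^ k) (n - k)"
    by (rule fps_power_nth_cong[where n = "n - k"])
       (use assms(2) in \<open>auto simp: central_bell_series_def\<close>)
  then show ?thesis
    by (simp add: central_bell_def central_bell_series_power_nth)
qed

end

theory Submission
  imports Defs
begin

text \<open>
  For \<open>x\<^sub>m = x\<^sup>m\<close> the series in the definition is \<open>exp (x t / 2) - exp (- x t / 2)\<close>; the binomial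
  theorem turns its \<open>k\<close>-th power into a combination of the exponentials \<open>exp ((l - k / 2) x t)\<close>,
  whose coefficients can be read off.
\<close>

lemma central_bell_series_powers:
  fixes x :: "'a::field_char_0"
  shows "central_bell_series (\<lambda>m. x ^ m) = fps_exp (x / 2) - fps_exp (- (x / 2))"
proof (rule fps_ext)
  fix m
  have "(- (x / 2)) ^ m = (- 1) ^ m * x ^ m / 2 ^ m"
    by (metis power_minus power_divide times_divide_eq_right)
  \<comment> \<open>The factor \<open>1 - (- 1) ^ m\<close> is the difference of the two
    exponentials' coefficients. The separate value 0 at \<open>m = 0\<close> fits, since both
    constant terms are 1 and cancel.\<close>
  then show "fps_nth (central_bell_series (\<lambda>m. x ^ m)) m =
      fps_nth (fps_exp (x / 2) - fps_exp (- (x / 2))) m"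
    by (simp add: central_bell_series_def power_divide diff_divide_distrib)
qed

text \<open>In the binomial expansion the \<open>l\<close>-th term multiplies \<open>l\<close>
  factors with exponent \<open>c\<close> and \<open>k - l\<close> factors with exponent
  \<open>- c\<close>, and the exponents add up.\<close>

lemma fps_exp_diff_power:
  fixes c :: "'a::field_char_0"
  shows "(fps_exp c - fps_exp (- c)) ^ k =
    (\<Sum>l\<le>k. fps_const (of_nat (k choose l) * (- 1) ^ (k - l)) * fps_exp ((2 * of_nat l - of_nat k) * c))"
proof -
  have "(fps_exp c - fps_exp (- c)) ^ k =
      (\<Sum>l\<le>k. of_nat (k choose l) * fps_exp c ^ l * (- fps_exp (- c)) ^ (k - l))"
    using binomial_ring[of "fps_exp c" "- fps_exp (- c)" k] by simp
  also have "\<dots> = (\<Sum>l\<le>k. fps_const (of_nat (k choose l) * (- 1) ^ (k - l)) *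
      fps_exp ((2 * of_nat l - of_nat k) * c))"
  proof (rule sum.cong)
    fix l assume "l \<in> {..k}"
    \<comment> \<open>Here \<open>l \<le> k\<close> makes the truncated subtraction
      \<open>k - l\<close> a genuine difference.\<close>
    then have "of_nat l * c + of_nat (k - l) * (- c) = (2 * of_nat l - of_nat k) * c"
      by (simp add: of_nat_diff algebra_simps)
    then have "fps_exp c ^ l * fps_exp (- c) ^ (k - l) = fps_exp ((2 * of_nat l - of_nat k) * c)"
      by (metis fps_exp_add_mult fps_exp_power_mult)
    moreover have "(- fps_exp (- c)) ^ (k - l) = fps_const ((- 1) ^ (k - l)) * fps_exp (- c) ^ (k - l)"
      by (subst power_minus) (simp flip: fps_const_power fps_const_neg)
    ultimately show "of_nat (k choose l) * fps_exp c ^ l * (- fps_exp (- c)) ^ (k - l) =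
        fps_const (of_nat (k choose l) * (- 1) ^ (k - l)) * fps_exp ((2 * of_nat l - of_nat k) * c)"
      by (simp add: fps_of_nat mult_ac flip: fps_const_mult)
  qed simp
  finally show ?thesis .
qed

text \<open>With \<open>c = x / 2\<close> the exponents become \<open>x * (l - k / 2)\<close>;
  taking the coefficient at \<open>n\<close>, \<open>fact n\<close> cancels the denominator and
  \<open>x ^ n\<close> factors out of every term.\<close>

lemma central_bell_powers:
  fixes x :: "'a::field_char_0"
  shows "central_bell n k (\<lambda>m. x ^ m) = x ^ n / fact k *
    (\<Sum>l=0..k. of_nat (k choose l) * (- 1) ^ (k - l) * (of_nat l - of_nat k / 2) ^ n)"
proof -
  have arg: "(2 * of_nat l - of_nat k) * (x / 2) = x * (of_nat l - of_nat k / 2)" for l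
    by (simp add: field_simps)
  have "fact n * fps_nth ((fps_exp (x / 2) - fps_exp (- (x / 2))) ^ k) n =
      x ^ n * (\<Sum>l=0..k. of_nat (k choose l) * (- 1) ^ (k - l) * (of_nat l - of_nat k / 2) ^ n)"
    unfolding fps_exp_diff_power arg
    by (simp add: fps_sum_nth sum_distrib_left power_mult_distrib mult_ac atLeast0AtMost)
  then show ?thesis
    by (simp add: central_bell_def central_bell_series_powers)
qed

text \<open>The series has no constant term, so its \<open>k\<close>-th power starts at degree
  \<open>k\<close> or later.\<close>

lemma central_bell_eq_0:
  assumes "n < k"
  shows "central_bell n k x = 0"
  using assms by (simp add: central_bell_def central_bell_series_power_nth)

theorem theorem2p2:
  fixes x :: "'a::field_char_0" and n k :: nat
  assumes "[int n - int k = 0] (mod 2)"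
  shows "x ^ n / fact k *
           (\<Sum>l=0..k. of_nat (k choose l) * (- 1) ^ (k - l) * (of_nat l - of_nat k / 2) ^ n) =
         (if n \<ge> k then central_bell n k (\<lambda>m. x ^ m) else 0)
       \<and>
         1 / fact k *
           (\<Sum>l=0..k. of_nat (k choose l) * (- 1) ^ (k - l) * (of_nat l - of_nat k / 2) ^ n) =
         (if n \<ge> k then central_bell n k (\<lambda>m. 1 :: 'a) else 0)"
  \<comment> \<open>The second identity is the case \<open>x = 1\<close>. For \<open>n < k\<close>
    the closed form still equals \<open>central_bell\<close>, which vanishes there.\<close>
  using central_bell_powers[of n k x] central_bell_powers[of n k "1 :: 'a"]
  by (auto simp: central_bell_eq_0)

end
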